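(* Let $(\rho,\overline{J})$ be a charge distribution and current satisfying the continuity equation $\frac{\partial\rho}{\partial t}+\nabla\cdot\overline{J}=0$ in the rest frame $S$, and suppose that $(\rho,\overline{J})$ is strongly non-radiating. Then $(\rho,\overline{J})$ is trivial, that is, $\rho=0$ and $\overline{J}=\overline{0}$.
   Context: All quantities are smooth functions of space and time, with charges scalar valued and currents and fields vector valued. $\epsilon_{0},\mu_{0}>0$ are constants and $c=1/\sqrt{\mu_{0}\epsilon_{0}}$. Maxwell's equations for $(\rho,\overline{J},\overline{E},\overline{B})$ are: $\nabla\cdot\overline{E}=\rho/\epsilon_{0}$, $\nabla\cdot\overline{B}=0$, $\nabla\times\overline{E}=-\frac{\partial\overline{B}}{\partial t}$, $\nabla\times\overline{B}=\mu_{0}\overline{J}+\mu_{0}\epsilon_{0}\frac{\partial\overline{E}}{\partial t}$. The inertial frame $S'$ with velocity vector $\overline{v}$ relative to $S$, $v=|\overline{v}|<c$, has coordinates $(\overline{x}',t')$ given by the Lorentz transformation $\overline{x}'_{||}=\gamma(\overline{x}_{||}-\overline{v}t)$, $\overline{x}'_{\perp}=\overline{x}_{\perp}$, $t'=\gamma(t-\overline{v}\cdot\overline{x}/c^{2})$, with $\gamma=(1-v^{2}/c^{2})^{-1/2}$, where $||$ and $\perp$ denote the components parallel and perpendicular to $\overline{v}$ (the case $\overline{v}=\overline{0}$ is $S$ itself). The transformed charge and current are $\rho'=\gamma(\rho-vJ_{||}/c^{2})$ and $\overline{J}'=\gamma(\overline{J}_{||}-\rho\overline{v})+\overline{J}_{\perp}$,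 where $vJ_{||}=\overline{v}\cdot\overline{J}$, regarded as functions of $(\overline{x}',t')$. Maxwell's equations in $S'$ are the same equations with respect to the coordinates $(\overline{x}',t')$. Definition: $(\rho,\overline{J})$, satisfying the continuity equation in $S$, is strongly non-radiating if in any inertial frame $S'$, with velocity vector $\overline{v}$, for the transformed current and charge $(\rho',\overline{J}')$, there exist electric and magnetic fields $(\overline{E}',\overline{B}')$ in $S'$ such that $(\rho',\overline{J}',\overline{E}',\overline{B}')$ satisfy Maxwell's equations in $S'$ and $\overline{E}'=\overline{0}$. *)

theory Defs
  imports "HOL-Analysis.Analysis"
begin

text \<open>A point of space-time is a pair of a position and a time, so that a charge density is a function
  of type \<open>spacetime \<Rightarrow> real\<close> and a current or field one of type \<open>spacetime \<Rightarrow> real ^ 3\<close>.\<close>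

type_synonym spacetime = "(real ^ 3) \<times> real"

text \<open>\<open>times_differentiable k f\<close>: \<open>f\<close> is of class \<open>C\<^sup>k\<close>, by recursion over directional derivatives.\<close>

primrec times_differentiable :: "nat \<Rightarrow> ('a::real_normed_vector \<Rightarrow> 'b::real_normed_vector) \<Rightarrow> bool" where
  "times_differentiable 0 f \<longleftrightarrow> continuous_on UNIV f"
| "times_differentiable (Suc k) f \<longleftrightarrow>
     (\<forall>x. f differentiable (at x)) \<and>
     (\<forall>u. times_differentiable k (\<lambda>x. frechet_derivative f (at x) u))"

definition smooth :: "('a::real_normed_vector \<Rightarrow> 'b::real_normed_vector) \<Rightarrow> bool" where
  "smooth f \<longleftrightarrow> (\<forall>k. times_differentiable k f)"

definition partial_space :: "3 \<Rightarrow> (spacetime \<Rightarrow> 'b::real_normed_vector) \<Rightarrow> spacetime \<Rightarrow> 'b" where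
  "partial_space i F p = vector_derivative (\<lambda>h. F (fst p + h *\<^sub>R axis i 1, snd p)) (at 0)"

definition partial_time :: "(spacetime \<Rightarrow> 'b::real_normed_vector) \<Rightarrow> spacetime \<Rightarrow> 'b" where
  "partial_time F p = vector_derivative (\<lambda>s. F (fst p, s)) (at (snd p))"

definition diverg :: "(spacetime \<Rightarrow> real ^ 3) \<Rightarrow> spacetime \<Rightarrow> real" where
  "diverg F p = (\<Sum>i\<in>UNIV. partial_space i (\<lambda>q. F q $ i) p)"

definition curl :: "(spacetime \<Rightarrow> real ^ 3) \<Rightarrow> spacetime \<Rightarrow> real ^ 3" where
  "curl F p = vector
     [partial_space 2 (\<lambda>q. F q $ 3) p - partial_space 3 (\<lambda>q. F q $ 2) p,
      partial_space 3 (\<lambda>q. F q $ 1) p - partial_space 1 (\<lambda>q. F q $ 3) p,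
      partial_space 1 (\<lambda>q. F q $ 2) p - partial_space 2 (\<lambda>q. F q $ 1) p]"

definition continuity_equation :: "(spacetime \<Rightarrow> real) \<Rightarrow> (spacetime \<Rightarrow> real ^ 3) \<Rightarrow> bool" where
  "continuity_equation \<rho> J \<longleftrightarrow> (\<forall>p. partial_time \<rho> p + diverg J p = 0)"

definition maxwell ::
  "real \<Rightarrow> real \<Rightarrow> (spacetime \<Rightarrow> real) \<Rightarrow> (spacetime \<Rightarrow> real ^ 3) \<Rightarrow>
   (spacetime \<Rightarrow> real ^ 3) \<Rightarrow> (spacetime \<Rightarrow> real ^ 3) \<Rightarrow> bool" where
  "maxwell \<epsilon>\<^sub>0 \<mu>\<^sub>0 \<rho> J E B \<longleftrightarrow>
     (\<forall>p. diverg E p = \<rho> p / \<epsilon>\<^sub>0) \<and>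
     (\<forall>p. diverg B p = 0) \<and>
     (\<forall>p. curl E p = - partial_time B p) \<and>
     (\<forall>p. curl B p = \<mu>\<^sub>0 *\<^sub>R J p + (\<mu>\<^sub>0 * \<epsilon>\<^sub>0) *\<^sub>R partial_time E p)"

definition light_speed :: "real \<Rightarrow> real \<Rightarrow> real" where
  "light_speed \<epsilon>\<^sub>0 \<mu>\<^sub>0 = 1 / sqrt (\<mu>\<^sub>0 * \<epsilon>\<^sub>0)"

definition lorentz_factor :: "real \<Rightarrow> real ^ 3 \<Rightarrow> real" where
  "lorentz_factor c v = 1 / sqrt (1 - (norm v)\<^sup>2 / c\<^sup>2)"

text \<open>For \<open>v = 0\<close> division by zero gives parallel component 0 and perpendicular component \<open>x\<close>, so that
  the transformations below reduce to the identity.\<close>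

definition par :: "real ^ 3 \<Rightarrow> real ^ 3 \<Rightarrow> real ^ 3" where
  "par v x = ((v \<bullet> x) / (v \<bullet> v)) *\<^sub>R v"

definition perp :: "real ^ 3 \<Rightarrow> real ^ 3 \<Rightarrow> real ^ 3" where
  "perp v x = x - par v x"

definition lorentz :: "real \<Rightarrow> real ^ 3 \<Rightarrow> spacetime \<Rightarrow> spacetime" where
  "lorentz c v = (\<lambda>(x, t).
     (lorentz_factor c v *\<^sub>R (par v x - t *\<^sub>R v) + perp v x,
      lorentz_factor c v * (t - (v \<bullet> x) / c\<^sup>2)))"

text \<open>The inverse of \<open>lorentz c v\<close> expresses the transformed sources as functions of the primed
  coordinates; it is a genuine two-sided inverse by \<open>bij_lorentz\<close>.\<close>

definition transformed_charge ::
  "real \<Rightarrow> real ^ 3 \<Rightarrow> (spacetime \<Rightarrow> real) \<Rightarrow> (spacetime \<Rightarrow> real ^ 3) \<Rightarrow> spacetime \<Rightarrow> real" where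
  "transformed_charge c v \<rho> J p' =
     (let p = inv (lorentz c v) p' in lorentz_factor c v * (\<rho> p - (v \<bullet> J p) / c\<^sup>2))"

definition transformed_current ::
  "real \<Rightarrow> real ^ 3 \<Rightarrow> (spacetime \<Rightarrow> real) \<Rightarrow> (spacetime \<Rightarrow> real ^ 3) \<Rightarrow> spacetime \<Rightarrow> real ^ 3" where
  "transformed_current c v \<rho> J p' =
     (let p = inv (lorentz c v) p' in
        lorentz_factor c v *\<^sub>R (par v (J p) - \<rho> p *\<^sub>R v) + perp v (J p))"

definition strongly_non_radiating ::
  "real \<Rightarrow> real \<Rightarrow> (spacetime \<Rightarrow> real) \<Rightarrow> (spacetime \<Rightarrow> real ^ 3) \<Rightarrow> bool" where
  "strongly_non_radiating \<epsilon>\<^sub>0 \<mu>\<^sub>0 \<rho> J \<longleftrightarrow>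
     continuity_equation \<rho> J \<and>
     (let c = light_speed \<epsilon>\<^sub>0 \<mu>\<^sub>0 in
      \<forall>v. norm v < c \<longrightarrow>
        (\<exists>E' B'. smooth E' \<and> smooth B' \<and>
           maxwell \<epsilon>\<^sub>0 \<mu>\<^sub>0 (transformed_charge c v \<rho> J) (transformed_current c v \<rho> J) E' B' \<and>
           (\<forall>p'. E' p' = 0)))"

lemma lorentz_minus_lorentz:
  assumes "norm v < c"
  shows "lorentz c (- v) (lorentz c v p) = p"
proof (cases "v = 0")
  case True
  then show ?thesis
    by (cases p) (simp add: lorentz_def lorentz_factor_def par_def perp_def)
next
  case False
  obtain x t where p: "p = (x, t)" by (cases p)
  define g where "g = lorentz_factor c v"
  define n where "n = v \<bullet> v"
  define a where "a = v \<bullet> x"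
  have n: "n > 0" using False by (simp add: n_def)
  have c: "c > 0" using assms norm_ge_zero[of v] by linarith
  have "(norm v)\<^sup>2 < c\<^sup>2" using assms by (simp add: power_strict_mono)
  then have nc: "n < c\<^sup>2" by (simp add: n_def dot_square_norm)
  have g: "g\<^sup>2 * (1 - n / c\<^sup>2) = 1"
  proof -
    have q: "0 < 1 - n / c\<^sup>2" using nc c by simp
    have "g = 1 / sqrt (1 - n / c\<^sup>2)" by (simp add: g_def lorentz_factor_def n_def dot_square_norm)
    then have "g\<^sup>2 = 1 / (1 - n / c\<^sup>2)" using q by (simp add: power_divide)
    moreover have "1 / r * r = 1" if "0 < r" for r :: real using that by simp
    ultimately show ?thesis using q by presburger
  qed
  have gm: "lorentz_factor c (- v) = g" by (simp add: g_def lorentz_factor_def)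
  define x' where "x' = g *\<^sub>R (par v x - t *\<^sub>R v) + perp v x"
  define t' where "t' = g * (t - a / c\<^sup>2)"
  have vp: "v \<bullet> par v x = a" using n by (simp add: par_def n_def a_def)
  have vx': "v \<bullet> x' = g * (a - t * n)"
    using vp by (simp add: x'_def perp_def inner_add_right inner_diff_right a_def n_def)
  have par_m: "par (- v) y = par v y" for y by (simp add: par_def)
  have parx': "par v x' = (g * (a / n - t)) *\<^sub>R v"
    using n vx' by (simp add: par_def n_def[symmetric] field_simps)
  have perpx': "perp v x' = perp v x"
  proof -
    have "x' = (g * (a / n - t)) *\<^sub>R v + perp v x"
      by (simp add: x'_def par_def a_def n_def algebra_simps)
    moreover have "perp v x' = x' - (g * (a / n - t)) *\<^sub>R v"
      by (simp only: perp_def parx')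
    ultimately show ?thesis by (metis add_diff_cancel_left')
  qed
  have co: "g * (g * (a / n - t) + t') = a / n"
  proof -
    have "g * (g * (a / n - t) + t') = (g\<^sup>2 * (1 - n / c\<^sup>2)) * (a / n)"
      using n by (simp add: t'_def power2_eq_square field_simps)
    then show ?thesis using g by simp
  qed
  have ti: "g * (t' + g * (a - t * n) / c\<^sup>2) = t"
  proof -
    have "g * (t' + g * (a - t * n) / c\<^sup>2) = (g\<^sup>2 * (1 - n / c\<^sup>2)) * t"
      using c by (simp add: t'_def power2_eq_square field_simps)
    then show ?thesis using g by simp
  qed
  have "g *\<^sub>R (par v x' + t' *\<^sub>R v) + perp v x' = par v x + perp v x"
  proof -
    have "g *\<^sub>R (par v x' + t' *\<^sub>R v) = (g * (g * (a / n - t) + t')) *\<^sub>R v"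
      by (simp add: parx' algebra_simps)
    also have "\<dots> = par v x" by (simp only: co) (simp add: par_def a_def n_def)
    finally show ?thesis by (simp add: perpx')
  qed
  then have s: "g *\<^sub>R (par v x' + t' *\<^sub>R v) + perp v x' = x" by (simp add: perp_def[of v x])
  have "lorentz c v p = (x', t')"
    by (simp add: p lorentz_def x'_def t'_def g_def a_def)
  moreover have "lorentz c (- v) (x', t') = (x, t)"
    using s ti by (simp add: lorentz_def gm par_m perp_def vx')
  ultimately show ?thesis by (simp add: p)
qed

lemma bij_lorentz:
  assumes "norm v < c"
  shows "bij (lorentz c v)"
proof (rule o_bij)
  show "lorentz c (- v) \<circ> lorentz c v = id"
    using lorentz_minus_lorentz[OF assms] by (simp add: fun_eq_iff)
  show "lorentz c v \<circ> lorentz c (- v) = id"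
    using lorentz_minus_lorentz[of "- v" c] assms by (simp add: fun_eq_iff)
qed

end

theory Submission
  imports Defs
begin

text \<open>Gauss's law turns \<open>E' = 0\<close> into \<open>\<rho>' = 0\<close>. If this holds in every inertial frame, then
  \<open>\<gamma> (\<rho> - v \<bullet> J / c\<^sup>2) = 0\<close> at every event for every subluminal \<open>v\<close>. At a fixed event this says
  that an affine function of \<open>v\<close> vanishes on the ball of radius \<open>c\<close>: its constant term \<open>\<rho>\<close> and its
  linear part \<open>J\<close> are both zero. The charge density alone, seen by all observers, thus determines
  the whole four-current.\<close>

lemma diverg_zero:
  assumes "\<And>q. E q = 0"
  shows "diverg E p = 0"
  by (simp add: diverg_def partial_space_def assms)

lemma lorentz_factor_pos:
  assumes "norm v < c"
  shows "lorentz_factor c v > 0"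
proof -
  have "c > 0" using assms norm_ge_zero[of v] by linarith
  moreover have "(norm v)\<^sup>2 < c\<^sup>2" using assms by (simp add: power_strict_mono)
  ultimately show ?thesis by (simp add: lorentz_factor_def)
qed

lemma transformed_charge_at_lorentz:
  assumes "norm v < c"
  shows "transformed_charge c v \<rho> J (lorentz c v p) =
    lorentz_factor c v * (\<rho> p - (v \<bullet> J p) / c\<^sup>2)"
  using bij_lorentz[OF assms] by (simp add: transformed_charge_def bij_is_inj)

lemma maxwell_zero_field_imp_zero_charge:
  assumes "maxwell \<epsilon>\<^sub>0 \<mu>\<^sub>0 \<rho> J E B" and "\<epsilon>\<^sub>0 \<noteq> 0" and "\<And>q. E q = 0"
  shows "\<rho> p = 0"
proof -
  have "diverg E p = \<rho> p / \<epsilon>\<^sub>0" using assms(1) unfolding maxwell_def by blast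
  then show ?thesis using diverg_zero[of E p] assms(2,3) by simp
qed

lemma strongly_non_radiating_charge_balance:
  assumes "strongly_non_radiating \<epsilon>\<^sub>0 \<mu>\<^sub>0 \<rho> J" and "\<epsilon>\<^sub>0 \<noteq> 0"
    and c: "c = light_speed \<epsilon>\<^sub>0 \<mu>\<^sub>0" and v: "norm v < c"
  shows "\<rho> p = (v \<bullet> J p) / c\<^sup>2"
proof -
  obtain E' B' where
    "maxwell \<epsilon>\<^sub>0 \<mu>\<^sub>0 (transformed_charge c v \<rho> J) (transformed_current c v \<rho> J) E' B'"
    and "\<And>q. E' q = 0"
    using assms(1) v unfolding strongly_non_radiating_def Let_def c by blast
  then have "transformed_charge c v \<rho> J (lorentz c v p) = 0"
    using \<open>\<epsilon>\<^sub>0 \<noteq> 0\<close> maxwell_zero_field_imp_zero_charge by blast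
  then show ?thesis
    using lorentz_factor_pos[OF v] by (simp add: transformed_charge_at_lorentz[OF v])
qed

lemma eq_zero_if_orthogonal_to_ball:
  fixes x :: "'a::real_inner"
  assumes "r > 0" and orth: "\<And>v. norm v < r \<Longrightarrow> v \<bullet> x = 0"
  shows "x = 0"
proof -
  \<comment> \<open>A positive multiple of \<open>x\<close> inside the ball; the summand 1 covers the case \<open>x = 0\<close>.\<close>
  define s where "s = r / (1 + norm x)"
  have d: "1 + norm x > 0" by (simp add: add_pos_nonneg)
  have s: "s > 0" using \<open>r > 0\<close> d by (simp add: s_def)
  have "norm (s *\<^sub>R x) < r"
    using \<open>r > 0\<close> d s by (simp add: s_def pos_divide_less_eq)
  from orth[OF this] s show ?thesis by simp
qed

theorem lemma2p9:
  fixes \<epsilon>\<^sub>0 \<mu>\<^sub>0 :: real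
    and \<rho> :: "spacetime \<Rightarrow> real"
    and J :: "spacetime \<Rightarrow> real ^ 3"
  assumes "\<epsilon>\<^sub>0 > 0" and "\<mu>\<^sub>0 > 0"
    and "smooth \<rho>" and "smooth J"
    and "continuity_equation \<rho> J"
    and "strongly_non_radiating \<epsilon>\<^sub>0 \<mu>\<^sub>0 \<rho> J"
  shows "(\<forall>p. \<rho> p = 0) \<and> (\<forall>p. J p = 0)"
proof -
  define c where "c = light_speed \<epsilon>\<^sub>0 \<mu>\<^sub>0"
  have "c > 0" using assms(1,2) by (simp add: c_def light_speed_def)
  have balance: "\<rho> p = (v \<bullet> J p) / c\<^sup>2" if "norm v < c" for v p
    using strongly_non_radiating_charge_balance[OF assms(6) _ c_def that] assms(1) by simp
  have rho: "\<rho> p = 0" for p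
    using balance[of 0 p] \<open>c > 0\<close> by simp
  have "J p = 0" for p
  proof (rule eq_zero_if_orthogonal_to_ball[OF \<open>c > 0\<close>])
    show "v \<bullet> J p = 0" if "norm v < c" for v
      using balance[OF that, of p] rho[of p] \<open>c > 0\<close> by simp
  qed
  with rho show ?thesis by blast
qed

end
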